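(* Let $K\subset\mathbb{R}^n$ be a self-dual cone and let $f\in\mathbb{R}[x_1,\dots,x_n]$ be a $K$-Lorentzian form of degree $d\ge2$. Then for all $a\in K$: (a) the Hessian matrix $H_f(a)$ of $f$ at $a$ is either nonsingular and $K$-irreducible, or singular and $K$-nonnegative; (b) $H_f(a)$ has exactly one positive eigenvalue.
   Context: A cone $K\subset\mathbb{R}^n$ is self-dual if $K=K^*=\{y:\langle y,x\rangle\ge0\ \forall x\in K\}$ (standard inner product); such a cone is a proper convex cone, i.e. closed, convex, pointed, with nonempty interior $\operatorname{int}K$. For $a\in\mathbb{R}^n$, $D_af=\sum_i a_i\,\partial f/\partial x_i$. A form (homogeneous polynomial) $f$ of degree $d\ge2$ is $K$-Lorentzian if for any $a_1,\dots,a_{d-2}\in\operatorname{int}K$ the quadratic form $q=D_{a_1}\cdots D_{a_{d-2}}f$, written $q(x)=x^tQx$ with $Q$ symmetric, satisfies: (1) $Q$ has exactly one positive eigenvalue; (2) $y^tQx>0$ for all $x,y\in\operatorname{int}K$. An $n\times n$ matrix $A$ is $K$-nonnegative if $A(K)\subseteq K$. A $K$-nonnegative matrix is $K$-irreducible if it leaves no proper face of $K$ (a face other than $\{0\}$ and $K$) invariant.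
   Formalization: Part (b) is asserted for all a in int K and for every other a in K with H_f(a) nonzero; as stated it fails where H_f(a) = 0, e.g. K = [0,∞), f = x^3, a = 0. Part (a) is unchanged. *)

theory Defs
  imports "HOL-Analysis.Analysis"
begin

text \<open>
  A form is represented by its polynomial function; over the reals it determines the
  polynomial. The exponents of total degree d are functions from the index type to nat.
\<close>

definition is_form :: "nat \<Rightarrow> (real^'n \<Rightarrow> real) \<Rightarrow> bool" where
  "is_form d f \<longleftrightarrow>
     (\<exists>c :: ('n \<Rightarrow> nat) \<Rightarrow> real. \<forall>x.
        f x = (\<Sum>\<alpha> | sum \<alpha> UNIV = d. c \<alpha> * (\<Prod>i\<in>UNIV. x $ i ^ \<alpha> i)))"

lemma finite_exponents: "finite {\<alpha> :: 'n::finite \<Rightarrow> nat. sum \<alpha> UNIV = d}"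
proof (rule finite_subset)
  show "{\<alpha> :: 'n \<Rightarrow> nat. sum \<alpha> UNIV = d} \<subseteq> (UNIV :: 'n set) \<rightarrow>\<^sub>E {..d}"
    by (auto simp: PiE_def intro: member_le_sum)
  show "finite ((UNIV :: 'n set) \<rightarrow>\<^sub>E {..d})"
    by (intro finite_PiE) auto
qed

definition partial_deriv :: "'n \<Rightarrow> (real^'n \<Rightarrow> real) \<Rightarrow> real^'n \<Rightarrow> real" where
  "partial_deriv i f x = deriv (\<lambda>t. f (x + t *\<^sub>R axis i 1)) 0"

definition dir_deriv :: "real^'n \<Rightarrow> (real^'n \<Rightarrow> real) \<Rightarrow> real^'n \<Rightarrow> real" where
  "dir_deriv a f x = (\<Sum>i\<in>UNIV. a $ i * partial_deriv i f x)"

definition hessian :: "(real^'n \<Rightarrow> real) \<Rightarrow> real^'n \<Rightarrow> real^'n^'n" where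
  "hessian f x = (\<chi> i j. partial_deriv i (partial_deriv j f) x)"

definition dual_cone :: "(real^'n) set \<Rightarrow> (real^'n) set" where
  "dual_cone K = {y. \<forall>x\<in>K. 0 \<le> y \<bullet> x}"

text \<open>
  Closedness, convexity, pointedness and nonempty interior are consequences of self-duality.
\<close>

definition self_dual_cone :: "(real^'n) set \<Rightarrow> bool" where
  "self_dual_cone K \<longleftrightarrow> cone K \<and> K = dual_cone K"

definition eigenspace :: "real^'n^'n \<Rightarrow> real \<Rightarrow> (real^'n) set" where
  "eigenspace A c = {v. A *v v = c *\<^sub>R v}"

text \<open>
  The positive eigenvalues are counted with multiplicity, as the dimension of the eigenspace.
  Below this is applied to symmetric matrices only, for which the geometric and the algebraic
  multiplicities agree. The index set of the sum is always finite.
\<close>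

definition num_pos_eigenvalues :: "real^'n^'n \<Rightarrow> nat" where
  "num_pos_eigenvalues A = (\<Sum>c | c > 0 \<and> (\<exists>v. v \<noteq> 0 \<and> A *v v = c *\<^sub>R v). dim (eigenspace A c))"

text \<open>
  The list \<open>as\<close> holds the directions of the d - 2 iterated derivatives. The symmetric matrix Q
  is determined by the quadratic form.
\<close>

definition K_lorentzian :: "(real^'n) set \<Rightarrow> nat \<Rightarrow> (real^'n \<Rightarrow> real) \<Rightarrow> bool" where
  "K_lorentzian K d f \<longleftrightarrow>
     2 \<le> d \<and> is_form d f \<and>
     (\<forall>as. length as = d - 2 \<and> set as \<subseteq> interior K \<longrightarrow>
        (\<exists>Q :: real^'n^'n. transpose Q = Q \<and>
           (\<forall>x. foldr dir_deriv as f x = x \<bullet> (Q *v x)) \<and>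
           num_pos_eigenvalues Q = 1 \<and>
           (\<forall>x\<in>interior K. \<forall>y\<in>interior K. 0 < y \<bullet> (Q *v x))))"

definition K_nonnegative :: "(real^'n) set \<Rightarrow> real^'n^'n \<Rightarrow> bool" where
  "K_nonnegative K A \<longleftrightarrow> (\<lambda>x. A *v x) ` K \<subseteq> K"

text \<open>
  For a closed convex cone, its faces as a cone are exactly its nonempty faces in the sense
  of \<open>face_of\<close>, which also admits the empty set.
\<close>

definition proper_face :: "(real^'n) set \<Rightarrow> (real^'n) set \<Rightarrow> bool" where
  "proper_face F K \<longleftrightarrow> F face_of K \<and> F \<noteq> {} \<and> F \<noteq> {0} \<and> F \<noteq> K"

definition K_irreducible :: "(real^'n) set \<Rightarrow> real^'n^'n \<Rightarrow> bool" where
  "K_irreducible K A \<longleftrightarrow>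
     K_nonnegative K A \<and> \<not> (\<exists>F. proper_face F K \<and> (\<lambda>x. A *v x) ` F \<subseteq> F)"

end

theory Submission
  imports Defs
begin

text \<open>
  Write \<open>H\<close> for the Hessian at a point \<open>a\<close>, and \<open>q(y) = y \<bullet> H y\<close>. For \<open>a\<close> in the interior
  of \<open>K\<close>, Euler's identity shows that differentiating a second partial derivative of \<open>f\<close>
  \<open>d - 2\<close> times in the direction \<open>a\<close> gives \<open>(d - 2)!\<close> times its value at \<open>a\<close>. Hence \<open>H\<close> is a
  positive multiple of the matrix \<open>Q\<close> that belongs to the directions \<open>a, \<dots>, a\<close>, and inherits
  its properties (\<open>hessian_iterated_dir_deriv\<close>).

  The number of positive eigenvalues is not continuous, so passing to boundary points needs a
  closed condition in its place. For a symmetric matrix with \<open>q(x) > 0\<close>, having exactly one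
  positive eigenvalue is equivalent to the reverse Cauchy--Schwarz inequality
  \<open>q(x) q(y) \<le> (x \<bullet> H y)\<^sup>2\<close> for all \<open>y\<close> (\<open>reverse_Cauchy_Schwarz_if_num_pos_eigenvalues_1\<close> and
  \<open>num_pos_eigenvalues_1_if_reverse_Cauchy_Schwarz\<close>). For fixed \<open>x\<close> in the interior of \<open>K\<close> this
  inequality and the inequalities \<open>y \<bullet> H x \<ge> 0\<close> survive the limit to every \<open>a\<close> in \<open>K\<close>
  (\<open>lorentzian_hessian_cone\<close>). By self-duality the latter say that \<open>H\<close> maps \<open>K\<close> to itself. When
  \<open>H \<noteq> 0\<close> they also give \<open>q(x) > 0\<close> for \<open>x\<close> in the interior
  (\<open>K_nonnegative_interior_pos\<close>), so that there is again exactly one positive eigenvalue.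

  Irreducibility of a nonsingular \<open>H\<close> (\<open>K_irreducible_if_reverse_Cauchy_Schwarz\<close>): let \<open>H\<close> map a
  proper face \<open>F\<close> to itself, take a nonzero \<open>v\<close> in \<open>F\<close>, and by separation a nonzero \<open>u\<close> in \<open>K\<close>
  that is orthogonal to \<open>F\<close>. Then \<open>q(u)\<close> and \<open>q(v)\<close> are nonnegative and \<open>u \<bullet> H v = 0\<close>, so \<open>q\<close> is
  nonnegative on the plane spanned by \<open>u\<close> and \<open>v\<close>. For \<open>x\<close> in the interior of \<open>K\<close> this plane
  meets the hyperplane \<open>x \<bullet> H w = 0\<close>, on which \<open>q\<close> is nonpositive, in a nonzero vector \<open>w\<close>. So
  \<open>q(w) = 0\<close>, a maximum of \<open>q\<close> on the hyperplane, which forces \<open>H w = 0\<close> and contradicts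
  nonsingularity.
\<close>

section \<open>Forms and their partial derivatives\<close>

text \<open>
  Polynomial functions that are homogeneous of degree \<open>d\<close>, generated from constants by sums and
  by products with a coordinate. Statements about derivatives are proved by rule induction, with
  the Leibniz rule for a coordinate factor as the only computation, and without reindexing sums
  over exponents.
\<close>

inductive hform :: "nat \<Rightarrow> (real^'n \<Rightarrow> real) \<Rightarrow> bool" where
  const: "hform 0 (\<lambda>x. c)"
| add: "hform d f \<Longrightarrow> hform d g \<Longrightarrow> hform d (\<lambda>x. f x + g x)"
| coord: "hform d f \<Longrightarrow> hform (Suc d) (\<lambda>x. x $ k * f x)"

lemma hform_zero: "hform d (\<lambda>x. 0)"
proof (induction d)
  case 0
  show ?case by (rule hform.const)
next
  case (Suc d)
  from hform.coord[OF this] show ?case by simp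
qed

lemma hform_scale: "hform d f \<Longrightarrow> hform d (\<lambda>x. c * f x)"
proof (induction rule: hform.induct)
  case (const b)
  show ?case by (rule hform.const)
next
  case (add d f g)
  then show ?case using hform.add[OF add.IH] by (simp add: distrib_left)
next
  case (coord d f k)
  then show ?case using hform.coord[OF coord.IH, of k] by (simp add: mult.left_commute)
qed

lemma hform_sum: "(\<And>s. s \<in> S \<Longrightarrow> hform d (F s)) \<Longrightarrow> hform d (\<lambda>x. \<Sum>s\<in>S. F s x)"
  by (induction S rule: infinite_finite_induct) (auto intro: hform_zero hform.add)

lemma hform_coord_power: "hform d f \<Longrightarrow> hform (k + d) (\<lambda>x. x $ i ^ k * f x)"
proof (induction k)
  case (Suc k)
  then show ?case using hform.coord[OF Suc.IH, of i] by (simp add: mult.assoc)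
qed simp

lemma hform_monomial: "finite S \<Longrightarrow> hform (sum \<alpha> S) (\<lambda>x. \<Prod>i\<in>S. x $ i ^ \<alpha> i)"
  by (induction S rule: finite_induct) (auto intro: hform.const hform_coord_power)

lemma is_form_imp_hform:
  fixes f :: "real^'n \<Rightarrow> real"
  assumes "is_form d f"
  shows "hform d f"
proof -
  obtain c where c: "f x = (\<Sum>\<alpha> | sum \<alpha> UNIV = d. c \<alpha> * (\<Prod>i\<in>UNIV. x $ i ^ \<alpha> i))" for x
    using assms unfolding is_form_def by blast
  have "hform d (\<lambda>x. \<Sum>\<alpha> | sum \<alpha> UNIV = d. c \<alpha> * (\<Prod>i\<in>UNIV. x $ i ^ \<alpha> i))"
  proof (rule hform_sum)
    fix \<alpha> :: "'n \<Rightarrow> nat"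
    assume "\<alpha> \<in> {\<alpha>. sum \<alpha> UNIV = d}"
    then have "hform d (\<lambda>x. \<Prod>i\<in>UNIV. x $ i ^ \<alpha> i)"
      using hform_monomial[of UNIV \<alpha>] by simp
    then show "hform d (\<lambda>x. c \<alpha> * (\<Prod>i\<in>UNIV. x $ i ^ \<alpha> i))" by (rule hform_scale)
  qed
  moreover have "f = (\<lambda>x. \<Sum>\<alpha> | sum \<alpha> UNIV = d. c \<alpha> * (\<Prod>i\<in>UNIV. x $ i ^ \<alpha> i))"
    using c by auto
  ultimately show ?thesis by metis
qed

lemma hform_continuous: "hform d f \<Longrightarrow> continuous_on UNIV f"
  by (induction rule: hform.induct) (auto intro!: continuous_intros)

lemma hform_differentiable:
  "hform d f \<Longrightarrow> (\<lambda>t. f (x + t *\<^sub>R v)) field_differentiable at 0"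
proof (induction rule: hform.induct)
  case (coord d f k)
  have "(\<lambda>t. x $ k + t * v $ k) field_differentiable at 0"
    by (auto simp: field_differentiable_def intro!: derivative_eq_intros)
  from field_differentiable_mult[OF this coord.IH] show ?case by simp
qed (auto intro: field_differentiable_add)

lemma partial_deriv_const: "partial_deriv i (\<lambda>x. c) = (\<lambda>x. 0)"
  by (simp add: partial_deriv_def fun_eq_iff)

lemma partial_deriv_add:
  assumes "hform d f" "hform e g"
  shows "partial_deriv i (\<lambda>x. f x + g x) = (\<lambda>x. partial_deriv i f x + partial_deriv i g x)"
  unfolding partial_deriv_def
  using hform_differentiable[OF assms(1)] hform_differentiable[OF assms(2)] by auto

lemma partial_deriv_coord:
  fixes f :: "real^'n \<Rightarrow> real" and i k :: 'n
  assumes "hform d f"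
  shows "partial_deriv i (\<lambda>x. x $ k * f x)
    = (\<lambda>x. (if i = k then 1 else 0) * f x + x $ k * partial_deriv i f x)"
proof
  fix x :: "real^'n"
  have "((\<lambda>t. x $ k + t * axis i 1 $ k) has_field_derivative axis i 1 $ k) (at 0)"
    by (auto intro!: derivative_eq_intros)
  moreover have "((\<lambda>t. f (x + t *\<^sub>R axis i 1)) has_field_derivative partial_deriv i f x) (at 0)"
    unfolding partial_deriv_def
    using hform_differentiable[OF assms] by (simp add: field_differentiable_derivI)
  ultimately have "((\<lambda>t. (x $ k + t * axis i 1 $ k) * f (x + t *\<^sub>R axis i 1)) has_field_derivative
     axis i 1 $ k * f x + x $ k * partial_deriv i f x) (at 0)"
    by (auto intro!: derivative_eq_intros)
  then show "partial_deriv i (\<lambda>x. x $ k * f x) x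
      = (if i = k then 1 else 0) * f x + x $ k * partial_deriv i f x"
    unfolding partial_deriv_def[of i "\<lambda>x. x $ k * f x"]
    by (auto simp: axis_def dest: DERIV_imp_deriv)
qed

text \<open>
  Degree 0 needs its own conjunct: \<open>x $ k\<close> times the derivative of a constant must have degree
  0, which holds only because that derivative vanishes.
\<close>

lemma hform_partial_deriv_aux:
  "hform d f \<Longrightarrow> (d = 0 \<longrightarrow> partial_deriv i f = (\<lambda>x. 0)) \<and> hform (d - 1) (partial_deriv i f)"
proof (induction rule: hform.induct)
  case (const c)
  then show ?case by (simp add: partial_deriv_const hform_zero)
next
  case (add d f g)
  then show ?case by (auto simp: partial_deriv_add intro: hform.add)
next
  case (coord d f k)
  have "hform d (\<lambda>x. x $ k * partial_deriv i f x)"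
  proof (cases d)
    case 0
    then show ?thesis using coord.IH by (simp add: hform_zero)
  next
    case (Suc e)
    then show ?thesis using hform.coord coord.IH by fastforce
  qed
  then show ?case
    using coord.hyps by (simp add: partial_deriv_coord hform.add hform_scale hform_zero)
qed

lemma hform_partial_deriv: "hform d f \<Longrightarrow> hform (d - 1) (partial_deriv i f)"
  using hform_partial_deriv_aux by blast

lemma partial_deriv_scale:
  assumes "hform d f"
  shows "partial_deriv i (\<lambda>x. c * f x) = (\<lambda>x. c * partial_deriv i f x)"
  unfolding partial_deriv_def using hform_differentiable[OF assms] by auto

lemma partial_deriv_sum:
  assumes "finite S" "\<And>s. s \<in> S \<Longrightarrow> hform d (F s)"
  shows "partial_deriv i (\<lambda>x. \<Sum>s\<in>S. F s x) = (\<lambda>x. \<Sum>s\<in>S. partial_deriv i (F s) x)"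
  using assms
proof (induction S rule: finite_induct)
  case empty
  then show ?case by (simp add: partial_deriv_const)
next
  case (insert s S)
  then show ?case using partial_deriv_add[of d "F s" d "\<lambda>x. \<Sum>s\<in>S. F s x"]
    by (simp add: hform_sum)
qed

text \<open>
  By the Leibniz rule, the mixed derivative of \<open>x $ k * f x\<close> is symmetric in the two indices as
  soon as that of \<open>f\<close> is.
\<close>

lemma partial_deriv_commute:
  "hform d f \<Longrightarrow> partial_deriv i (partial_deriv j f) = partial_deriv j (partial_deriv i f)"
proof (induction rule: hform.induct)
  case (const c)
  then show ?case by (simp add: partial_deriv_const)
next
  case (add d f g)
  then show ?case
    by (simp add: partial_deriv_add[OF add.hyps]
        partial_deriv_add[OF add.hyps[THEN hform_partial_deriv]])
next
  case (coord d f k)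
  note f = coord.hyps
  have *: "partial_deriv a (partial_deriv b (\<lambda>x. x $ k * f x)) =
     (\<lambda>x. (if b = k then 1 else 0) * partial_deriv a f x
        + ((if a = k then 1 else 0) * partial_deriv b f x
           + x $ k * partial_deriv a (partial_deriv b f) x))" for a b
    unfolding partial_deriv_coord[OF f]
      partial_deriv_add[OF hform_scale[OF f] hform.coord[OF hform_partial_deriv[OF f]]]
      partial_deriv_scale[OF f] partial_deriv_coord[OF hform_partial_deriv[OF f]] ..
  show ?case unfolding * coord.IH by auto
qed

lemma hform_dir_deriv:
  assumes "hform d f"
  shows "hform (d - 1) (dir_deriv a f)"
proof -
  have "hform (d - 1) (\<lambda>x. \<Sum>i\<in>UNIV. a $ i * partial_deriv i f x)"
    by (intro hform_sum hform_scale hform_partial_deriv assms)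
  then show ?thesis by (simp add: dir_deriv_def[abs_def])
qed

lemma partial_deriv_dir_deriv:
  assumes "hform d f"
  shows "partial_deriv i (dir_deriv a f) = dir_deriv a (partial_deriv i f)"
proof -
  have "partial_deriv i (dir_deriv a f) =
      (\<lambda>x. \<Sum>j\<in>UNIV. a $ j * partial_deriv i (partial_deriv j f) x)"
    unfolding dir_deriv_def[abs_def]
    by (subst partial_deriv_sum[where d = "d - 1"])
       (simp_all add: partial_deriv_scale[OF hform_partial_deriv[OF assms]]
         hform_scale hform_partial_deriv[OF assms, simplified])
  then show ?thesis
    by (simp add: dir_deriv_def[abs_def] partial_deriv_commute[OF assms, of i])
qed

lemma euler_identity: "hform d f \<Longrightarrow> dir_deriv x f x = d * f x"
proof (induction rule: hform.induct)
  case (const c)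
  then show ?case by (simp add: dir_deriv_def partial_deriv_const)
next
  case (add d f g)
  then show ?case
    by (simp add: dir_deriv_def partial_deriv_add distrib_left sum.distrib)
next
  case (coord d f k)
  have "dir_deriv x (\<lambda>x. x $ k * f x) x = (\<Sum>i\<in>UNIV. (if i = k then x $ i * f x else 0)
      + x $ k * (x $ i * partial_deriv i f x))"
    unfolding dir_deriv_def partial_deriv_coord[OF coord.hyps]
    by (intro sum.cong) (auto simp: algebra_simps)
  also have "\<dots> = x $ k * f x + x $ k * dir_deriv x f x"
    by (simp add: sum.distrib sum_distrib_left[symmetric] dir_deriv_def)
  finally show ?case by (simp add: coord.IH algebra_simps)
qed

lemma partial_deriv_iterated_dir_deriv:
  "hform d f \<Longrightarrow> partial_deriv i ((dir_deriv a ^^ m) f) = (dir_deriv a ^^ m) (partial_deriv i f)"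
proof (induction m arbitrary: d f)
  case (Suc m)
  from Suc.IH[OF hform_dir_deriv[OF Suc.prems]] show ?case
    by (simp add: funpow_swap1 partial_deriv_dir_deriv[OF Suc.prems] del: funpow.simps)
       (simp add: funpow_swap1 partial_deriv_dir_deriv[OF Suc.prems])
qed simp

text \<open>
  By Euler's identity at the point \<open>a\<close>, each derivative in the direction \<open>a\<close> multiplies the
  value at \<open>a\<close> by the current degree. After \<open>m\<close> steps the function is constant, so its value at
  \<open>a\<close> is its value everywhere.
\<close>

lemma iterated_dir_deriv_full:
  "hform m h \<Longrightarrow> (dir_deriv a ^^ m) h x = fact m * h a"
proof (induction m arbitrary: h)
  case 0
  then show ?case by (induction "0::nat" h rule: hform.induct) auto
next
  case (Suc m)
  have "hform m (dir_deriv a h)" using hform_dir_deriv[OF Suc.prems] by simp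
  from Suc.IH[OF this] show ?case
    by (simp add: funpow_swap1 euler_identity[OF Suc.prems] algebra_simps)
qed

text \<open>
  Links the quadratic form obtained from the directions \<open>a, \<dots>, a\<close> to the Hessian at the point
  \<open>a\<close>: partial derivatives commute with \<open>dir_deriv a\<close>, and the second partial derivatives of
  \<open>f\<close> are forms of degree \<open>m\<close>.
\<close>

lemma hessian_iterated_dir_deriv:
  assumes "hform (m + 2) f"
  shows "hessian ((dir_deriv a ^^ m) f) x = fact m *\<^sub>R hessian f a"
proof -
  have "partial_deriv i (partial_deriv j ((dir_deriv a ^^ m) f)) x
      = fact m * partial_deriv i (partial_deriv j f) a" for i j
  proof -
    have 1: "hform (m + 1) (partial_deriv j f)"
      using hform_partial_deriv[OF assms, of j] by simp
    have 2: "hform m (partial_deriv i (partial_deriv j f))"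
      using hform_partial_deriv[OF 1, of i] by simp
    show ?thesis
      by (simp add: partial_deriv_iterated_dir_deriv[OF assms]
          partial_deriv_iterated_dir_deriv[OF 1] iterated_dir_deriv_full[OF 2])
  qed
  then show ?thesis by (simp add: hessian_def vec_eq_iff)
qed

lemma symmetric_inner_commute:
  fixes A :: "real^'n^'n"
  assumes "transpose A = A"
  shows "x \<bullet> (A *v y) = y \<bullet> (A *v x)"
  by (metis assms dot_lmul_matrix inner_commute transpose_matrix_vector)

lemma hessian_quadratic_form:
  fixes Q :: "real^'n^'n"
  assumes "transpose Q = Q"
  shows "hessian (\<lambda>x. x \<bullet> (Q *v x)) a = 2 *\<^sub>R Q"
proof -
  have pd: "partial_deriv j (\<lambda>x. x \<bullet> (Q *v x)) = (\<lambda>x. 2 * (axis j 1 \<bullet> (Q *v x)))" for j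
  proof
    fix x
    let ?e = "axis j 1 :: real^'n"
    have "(x + t *\<^sub>R ?e) \<bullet> (Q *v (x + t *\<^sub>R ?e))
        = x \<bullet> (Q *v x) + t * (2 * (?e \<bullet> (Q *v x))) + t\<^sup>2 * (?e \<bullet> (Q *v ?e))" for t
      using symmetric_inner_commute[OF assms, of x ?e]
      by (simp add: matrix_vector_right_distrib matrix_vector_mult_scaleR inner_add
          power2_eq_square algebra_simps)
    then show "partial_deriv j (\<lambda>x. x \<bullet> (Q *v x)) x = 2 * (?e \<bullet> (Q *v x))"
      unfolding partial_deriv_def
      by (auto intro!: DERIV_imp_deriv derivative_eq_intros)
  qed
  have "partial_deriv i (\<lambda>x. 2 * (axis j 1 \<bullet> (Q *v x))) a = 2 * Q $ i $ j" for i j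
  proof -
    have "axis j 1 \<bullet> (Q *v axis i 1) = Q $ j $ i"
      by (simp add: inner_axis' matrix_vector_mul_component inner_axis)
    also have "\<dots> = Q $ i $ j" by (metis assms transpose_def vec_lambda_beta)
    finally have "2 * (axis j 1 \<bullet> (Q *v (a + t *\<^sub>R axis i 1)))
      = 2 * (axis j 1 \<bullet> (Q *v a)) + t * (2 * Q $ i $ j)" for t
      by (simp add: matrix_vector_right_distrib matrix_vector_mult_scaleR inner_add_right
          algebra_simps)
    then show ?thesis
      unfolding partial_deriv_def by (auto intro!: DERIV_imp_deriv derivative_eq_intros)
  qed
  then show ?thesis by (simp add: hessian_def pd vec_eq_iff)
qed

lemma transpose_hessian: "hform d f \<Longrightarrow> transpose (hessian f a) = hessian f a"
  by (simp add: transpose_def hessian_def vec_eq_iff) (metis partial_deriv_commute)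

lemma continuous_on_hessian:
  assumes "hform d f"
  shows "continuous_on UNIV (\<lambda>a. hessian f a)"
  unfolding hessian_def
  by (intro continuous_on_vec_lambda hform_continuous[OF hform_partial_deriv[OF
        hform_partial_deriv[OF assms]]])


section \<open>Symmetric matrices with exactly one positive eigenvalue\<close>

text \<open>
  The first-order condition at a minimum, for a quadratic polynomial in \<open>s\<close> that vanishes at 0.
\<close>

lemma linear_coeff_zero:
  fixes b c :: real
  assumes "\<And>s. 0 \<le> 2 * s * b + s\<^sup>2 * c"
  shows "b = 0"
proof (rule ccontr)
  assume "b \<noteq> 0"
  \<comment> \<open>At \<open>s = - b / k\<close> with \<open>k > c\<close> the linear term outweighs the quadratic one.\<close>
  define k where "k = \<bar>c\<bar> + 1"
  have k: "0 < k" "c < k" by (auto simp: k_def)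
  let ?s = "- b / k"
  have "2 * ?s * b + ?s\<^sup>2 * c = (b\<^sup>2 / k) * (c / k - 2)"
    using k(1) by (simp add: power2_eq_square field_simps)
  moreover have "c / k - 2 < 0" using k by (simp add: field_simps)
  then have "(b\<^sup>2 / k) * (c / k - 2) < 0"
    using k(1) \<open>b \<noteq> 0\<close> by (intro mult_pos_neg) auto
  ultimately show False using assms[of ?s] by linarith
qed

lemma quadratic_form_add_scaleR:
  fixes A :: "real^'n^'n"
  assumes "transpose A = A"
  shows "(x + s *\<^sub>R y) \<bullet> (A *v (x + s *\<^sub>R y))
    = x \<bullet> (A *v x) + 2 * s * (x \<bullet> (A *v y)) + s\<^sup>2 * (y \<bullet> (A *v y))"
  using symmetric_inner_commute[OF assms, of x y]
  by (simp add: matrix_vector_right_distrib matrix_vector_mult_scaleR inner_add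
      power2_eq_square algebra_simps)

text \<open>
  The quadratic form attains its maximum on the unit sphere of \<open>S\<close>, and a maximizer is an
  eigenvector with the maximum as its eigenvalue.
\<close>

lemma positive_eigenvector_in_invariant_subspace:
  fixes A :: "real^'n^'n"
  assumes sym: "transpose A = A" and S: "subspace S" "\<And>y. y \<in> S \<Longrightarrow> A *v y \<in> S"
    and x: "x \<in> S" "0 < x \<bullet> (A *v x)"
  obtains v c where "v \<in> S" "v \<noteq> 0" "0 < c" "A *v v = c *\<^sub>R v"
proof -
  let ?q = "\<lambda>y. y \<bullet> (A *v y)"
  have "x \<noteq> 0" using x by auto
  have "compact (sphere 0 1 \<inter> S)"
    by (intro compact_Int_closed compact_sphere closed_subspace S)
  moreover have "(1 / norm x) *\<^sub>R x \<in> sphere 0 1 \<inter> S"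
    using \<open>x \<noteq> 0\<close> x S by (auto intro: subspace_scale)
  moreover have "continuous_on (sphere 0 1 \<inter> S) ?q"
    by (intro continuous_intros linear_continuous_on matrix_vector_mul_bounded_linear)
  ultimately obtain v where v: "v \<in> sphere 0 1 \<inter> S"
    and max: "\<And>y. y \<in> sphere 0 1 \<inter> S \<Longrightarrow> ?q y \<le> ?q v"
    using continuous_attains_sup[of "sphere 0 1 \<inter> S" ?q] by blast
  define c where "c = ?q v"
  have bound: "?q y \<le> c * (y \<bullet> y)" if "y \<in> S" for y
  proof (cases "y = 0")
    case False
    have "(1 / norm y) *\<^sub>R y \<in> sphere 0 1 \<inter> S"
      using False that S by (auto intro: subspace_scale)
    from max[OF this] have "?q y / (y \<bullet> y) \<le> c"
      by (simp add: c_def matrix_vector_mult_scaleR dot_square_norm power2_eq_square)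
    then show ?thesis using False by (simp add: divide_le_eq)
  qed simp
  have "0 < c" using bound[OF x(1)] x(2) \<open>x \<noteq> 0\<close>
    by (smt (verit) inner_gt_zero_iff mult_nonpos_nonneg)
  have vv: "v \<bullet> v = 1" using v by (simp add: dot_square_norm)
  define z where "z = c *\<^sub>R v - A *v v"
  have "z \<in> S" using v S by (auto simp: z_def intro: subspace_diff subspace_scale)
  \<comment> \<open>On \<open>S\<close> the form \<open>c * (y \<bullet> y) - y \<bullet> (A *v y)\<close> is nonnegative and vanishes at \<open>v\<close>, so its
    derivative at \<open>v\<close> in the direction \<open>z\<close>, which is \<open>2 * (z \<bullet> z)\<close>, must be zero.\<close>
  have "0 \<le> 2 * s * (z \<bullet> z) + s\<^sup>2 * (c * (z \<bullet> z) - ?q z)" for s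
  proof -
    have "v + s *\<^sub>R z \<in> S" using v \<open>z \<in> S\<close> S by (auto intro: subspace_add subspace_scale)
    from bound[OF this] have "?q v + 2 * s * (v \<bullet> (A *v z)) + s\<^sup>2 * ?q z
        \<le> c + 2 * s * (c * (v \<bullet> z)) + s\<^sup>2 * (c * (z \<bullet> z))"
      unfolding quadratic_form_add_scaleR[OF sym]
      by (simp add: inner_add vv inner_commute power2_eq_square algebra_simps)
    moreover have "z \<bullet> (c *\<^sub>R v - A *v v) = c * (v \<bullet> z) - v \<bullet> (A *v z)"
      using symmetric_inner_commute[OF sym, of z v]
      by (simp add: inner_diff_right inner_commute)
    then have "c * (v \<bullet> z) = z \<bullet> z + v \<bullet> (A *v z)" by (simp only: z_def[symmetric])
    ultimately show ?thesis by (simp add: c_def[symmetric] distrib_left right_diff_distrib)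
  qed
  then have "z \<bullet> z = 0" by (rule linear_coeff_zero)
  then have "A *v v = c *\<^sub>R v" by (simp add: z_def)
  with that v \<open>0 < c\<close> show ?thesis by fastforce
qed

lemma orthogonal_eigenvectors:
  fixes A :: "real^'n^'n"
  assumes "transpose A = A" "A *v u = c *\<^sub>R u" "A *v v = b *\<^sub>R v" "c \<noteq> b"
  shows "u \<bullet> v = 0"
  using symmetric_inner_commute[OF assms(1), of u v] assms(2-4) by (simp add: inner_commute)

lemma subspace_eigenspace: "subspace (eigenspace A c)"
  by (auto simp: subspace_def eigenspace_def matrix_vector_right_distrib
      matrix_vector_mult_scaleR scaleR_right_distrib)

definition no_orthogonal_positive_eigenvectors :: "real^'n^'n \<Rightarrow> bool" where
  "no_orthogonal_positive_eigenvectors A \<longleftrightarrow> \<not> (\<exists>u v c b. u \<noteq> 0 \<and> v \<noteq> 0 \<and> u \<bullet> v = 0 \<and> 0 < c \<and> 0 < b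
     \<and> A *v u = c *\<^sub>R u \<and> A *v v = b *\<^sub>R v)"

lemma no_orthogonal_positive_eigenvectorsD:
  "\<lbrakk>no_orthogonal_positive_eigenvectors A; u \<bullet> v = 0; A *v u = c *\<^sub>R u; A *v v = b *\<^sub>R v; u \<noteq> 0; 0 < c; 0 < b\<rbrakk>
    \<Longrightarrow> v = 0"
  unfolding no_orthogonal_positive_eigenvectors_def by blast

text \<open>
  Counting with multiplicity becomes a statement about pairs: a second positive eigenvalue, or a
  second dimension in the eigenspace of the first, both yield two orthogonal eigenvectors.
\<close>

lemma num_pos_eigenvalues_eq_1_iff:
  fixes A :: "real^'n^'n"
  assumes sym: "transpose A = A"
  shows "num_pos_eigenvalues A = 1 \<longleftrightarrow>
    (\<exists>v c. v \<noteq> 0 \<and> 0 < c \<and> A *v v = c *\<^sub>R v) \<and> no_orthogonal_positive_eigenvectors A"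
    (is "?L \<longleftrightarrow> ?ex \<and> ?no")
proof -
  define C where "C = {c. c > 0 \<and> (\<exists>v. v \<noteq> 0 \<and> A *v v = c *\<^sub>R v)}"
  have num: "num_pos_eigenvalues A = (\<Sum>c\<in>C. dim (eigenspace A c))"
    by (simp add: num_pos_eigenvalues_def C_def)
  have dim_pos: "1 \<le> dim (eigenspace A c)" if c: "c \<in> C" for c
  proof -
    obtain v where "v \<noteq> 0" "v \<in> eigenspace A c"
      using c by (auto simp: C_def eigenspace_def)
    then have "\<not> eigenspace A c \<subseteq> {0}" by blast
    then have "dim (eigenspace A c) \<noteq> 0" by (simp only: dim_eq_0 not_False_eq_True)
    then show ?thesis by linarith
  qed
  show ?thesis
  proof (intro iffI conjI)
    assume L: ?L
    \<comment> \<open>A sum over an infinite set would be 0.\<close>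
    have "finite C" using L unfolding num by (rule contrapos_pp) simp
    have "C \<noteq> {}" using L unfolding num by (rule contrapos_pn) simp
    then obtain c where "c \<in> C" by blast
    then show ?ex unfolding C_def by blast
    show ?no unfolding no_orthogonal_positive_eigenvectors_def
    proof (intro notI, elim exE conjE)
      fix u v c b
      assume uv: "u \<noteq> 0" "v \<noteq> 0" "u \<bullet> v = 0" "0 < c" "0 < b"
        and ev: "A *v u = c *\<^sub>R u" "A *v v = b *\<^sub>R v"
      then have cC: "c \<in> C" "b \<in> C" by (auto simp: C_def)
      show False
      proof (cases "c = b")
        case True
        have "u \<noteq> v" using uv by auto
        have "pairwise orthogonal {u, v}"
          using uv by (auto simp: pairwise_def orthogonal_def inner_commute)
        then have "independent {u, v}"
          using uv by (intro pairwise_orthogonal_independent) auto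
        then have "card {u, v} \<le> dim (eigenspace A c)"
          using ev True by (intro independent_card_le_dim) (auto simp: eigenspace_def)
        then have "2 \<le> dim (eigenspace A c)" using \<open>u \<noteq> v\<close> by simp
        also have "\<dots> \<le> num_pos_eigenvalues A"
          unfolding num using \<open>finite C\<close> cC by (intro member_le_sum) auto
        finally show False using L by simp
      next
        case False
        have "2 \<le> dim (eigenspace A c) + dim (eigenspace A b)"
          using dim_pos[OF cC(1)] dim_pos[OF cC(2)] by simp
        also have "\<dots> = (\<Sum>c\<in>{c, b}. dim (eigenspace A c))" using False by simp
        also have "\<dots> \<le> num_pos_eigenvalues A"
          unfolding num using \<open>finite C\<close> cC by (intro sum_mono2) auto
        finally show False using L by simp
      qed
    qed
  next
    assume "?ex \<and> ?no"
    then obtain v c where v: "v \<noteq> 0" "0 < c" "A *v v = c *\<^sub>R v" and no: ?no by blast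
    have "C = {c}"
    proof (intro set_eqI iffI)
      fix b assume "b \<in> C"
      then obtain u where u: "0 < b" "u \<noteq> 0" "A *v u = b *\<^sub>R u" by (auto simp: C_def)
      then have "v \<bullet> u \<noteq> 0" using no_orthogonal_positive_eigenvectorsD[OF no _ v(3) u(3) v(1) v(2)] by blast
      then show "b \<in> {c}" using orthogonal_eigenvectors[OF sym v(3) u(3)] by auto
    next
      fix b assume "b \<in> {c}"
      then show "b \<in> C" using v unfolding C_def by blast
    qed
    moreover have "eigenspace A c \<subseteq> span {v}"
    proof
      fix w assume w: "w \<in> eigenspace A c"
      let ?t = "(v \<bullet> w) / (v \<bullet> v)"
      have "w - ?t *\<^sub>R v \<in> eigenspace A c"
        using w v by (intro subspace_diff subspace_scale subspace_eigenspace)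
          (auto simp: eigenspace_def)
      moreover have "v \<bullet> (w - ?t *\<^sub>R v) = 0" using v by (simp add: inner_diff_right)
      ultimately have "w - ?t *\<^sub>R v = 0"
        using no_orthogonal_positive_eigenvectorsD[OF no _ v(3) _ v(1) v(2) v(2)]
        unfolding eigenspace_def by blast
      then show "w \<in> span {v}" by (simp add: span_singleton)
    qed
    then have "dim (eigenspace A c) \<le> 1"
      using dim_le_card[of "eigenspace A c" "{v}"] by simp
    ultimately show ?L unfolding num using dim_pos[of c] by simp
  qed
qed

text \<open>
  For \<open>x \<bullet> (A *v x) > 0\<close> this says that the form is nonpositive on the complement of \<open>x\<close> with
  respect to the form. Unlike a count of eigenvalues, it is closed in \<open>A\<close> for fixed \<open>x\<close>.
\<close>

definition reverse_Cauchy_Schwarz :: "real^'n^'n \<Rightarrow> real^'n \<Rightarrow> bool" where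
  "reverse_Cauchy_Schwarz A x \<longleftrightarrow> (\<forall>y. (x \<bullet> (A *v x)) * (y \<bullet> (A *v y)) \<le> (x \<bullet> (A *v y))\<^sup>2)"

text \<open>
  If \<open>e\<close> is the positive eigenvector, the form is nonpositive on the orthogonal complement of
  \<open>e\<close>, as a positive value there would produce a second positive eigenvector. The plane spanned
  by \<open>x\<close> and \<open>y\<close> meets this complement in a vector \<open>y + t x\<close>, and completing the square there
  gives the inequality.
\<close>

lemma reverse_Cauchy_Schwarz_if_num_pos_eigenvalues_1:
  fixes A :: "real^'n^'n"
  assumes sym: "transpose A = A" and num: "num_pos_eigenvalues A = 1"
    and x: "0 < x \<bullet> (A *v x)"
  shows "reverse_Cauchy_Schwarz A x"
  unfolding reverse_Cauchy_Schwarz_def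
proof
  fix y
  let ?q = "\<lambda>y. y \<bullet> (A *v y)"
  obtain e c where e: "e \<noteq> 0" "0 < c" "A *v e = c *\<^sub>R e" and no: "no_orthogonal_positive_eigenvectors A"
    using num unfolding num_pos_eigenvalues_eq_1_iff[OF sym] by blast
  have neg: "?q w \<le> 0" if w: "e \<bullet> w = 0" for w
  proof (rule ccontr)
    assume "\<not> ?q w \<le> 0"
    then have "0 < ?q w" by simp
    have "subspace {w. e \<bullet> w = 0}" by (rule subspace_hyperplane)
    have "A *v w \<in> {w. e \<bullet> w = 0}" if "w \<in> {w. e \<bullet> w = 0}" for w
      using that symmetric_inner_commute[OF sym, of e w] e by (simp add: inner_commute)
    then obtain v b where "v \<in> {w. e \<bullet> w = 0}" "v \<noteq> 0" "0 < b" "A *v v = b *\<^sub>R v"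
      using positive_eigenvector_in_invariant_subspace[OF sym \<open>subspace {w. e \<bullet> w = 0}\<close> _ _ \<open>0 < ?q w\<close>]
        w by blast
    then show False using no_orthogonal_positive_eigenvectorsD[OF no _ e(3) _ e(1) e(2)] by blast
  qed
  have "e \<bullet> x \<noteq> 0" using neg[of x] x by auto
  define t where "t = - (e \<bullet> y) / (e \<bullet> x)"
  have "t * (e \<bullet> x) = - (e \<bullet> y)" using \<open>e \<bullet> x \<noteq> 0\<close> by (simp add: t_def)
  then have "e \<bullet> (y + t *\<^sub>R x) = 0" by (simp add: inner_add_right)
  from neg[OF this] have "?q y + 2 * t * (x \<bullet> (A *v y)) + t\<^sup>2 * ?q x \<le> 0"
    unfolding quadratic_form_add_scaleR[OF sym] symmetric_inner_commute[OF sym, of y x] .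
  then have "?q x * (?q y + 2 * t * (x \<bullet> (A *v y)) + t\<^sup>2 * ?q x) \<le> 0"
    using x by (simp add: mult_nonneg_nonpos)
  moreover have "?q x * (?q y + 2 * t * (x \<bullet> (A *v y)) + t\<^sup>2 * ?q x)
      = ?q x * ?q y - (x \<bullet> (A *v y))\<^sup>2 + (x \<bullet> (A *v y) + t * ?q x)\<^sup>2"
    by (simp add: power2_eq_square algebra_simps)
  moreover have "0 \<le> (x \<bullet> (A *v y) + t * ?q x)\<^sup>2" by simp
  ultimately show "?q x * ?q y \<le> (x \<bullet> (A *v y))\<^sup>2" by linarith
qed

text \<open>
  Two orthogonal positive eigenvectors would span a plane on which the form is positive definite,
  but this plane contains a nonzero \<open>w\<close> with \<open>x \<bullet> (A *v w) = 0\<close>, where the form is nonpositive.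
\<close>

lemma num_pos_eigenvalues_1_if_reverse_Cauchy_Schwarz:
  fixes A :: "real^'n^'n"
  assumes sym: "transpose A = A" and x: "0 < x \<bullet> (A *v x)" and CS: "reverse_Cauchy_Schwarz A x"
  shows "num_pos_eigenvalues A = 1"
  unfolding num_pos_eigenvalues_eq_1_iff[OF sym]
proof
  show "\<exists>v c. v \<noteq> 0 \<and> 0 < c \<and> A *v v = c *\<^sub>R v"
    using positive_eigenvector_in_invariant_subspace[OF sym subspace_UNIV, of x] x by blast
  show "no_orthogonal_positive_eigenvectors A"
    unfolding no_orthogonal_positive_eigenvectors_def
  proof (intro notI, elim exE conjE)
    fix u v c b
    assume uv: "u \<noteq> 0" "v \<noteq> 0" "u \<bullet> v = 0" "0 < c" "0 < b"
      and ev: "A *v u = c *\<^sub>R u" "A *v v = b *\<^sub>R v"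
    let ?w = "\<lambda>r s. r *\<^sub>R u + s *\<^sub>R v"
    obtain r s :: real where rs: "r \<noteq> 0 \<or> s \<noteq> 0" "r * (x \<bullet> (A *v u)) + s * (x \<bullet> (A *v v)) = 0"
    proof (cases "x \<bullet> (A *v u) = 0")
      case True
      then show ?thesis using that[of 1 0] by simp
    next
      case False
      then show ?thesis using that[of "- (x \<bullet> (A *v v))" "x \<bullet> (A *v u)"] by simp
    qed
    then have "x \<bullet> (A *v ?w r s) = 0"
      by (simp add: matrix_vector_right_distrib matrix_vector_mult_scaleR inner_add_right)
    then have "(x \<bullet> (A *v x)) * (?w r s \<bullet> (A *v ?w r s)) \<le> 0"
      using CS unfolding reverse_Cauchy_Schwarz_def by (metis zero_power2)
    then have "?w r s \<bullet> (A *v ?w r s) \<le> 0" using x by (simp add: mult_le_0_iff)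
    moreover have "?w r s \<bullet> (A *v ?w r s) = r\<^sup>2 * (c * (u \<bullet> u)) + s\<^sup>2 * (b * (v \<bullet> v))"
      using uv by (simp add: matrix_vector_right_distrib matrix_vector_mult_scaleR ev inner_add
          inner_commute[of v u] power2_eq_square algebra_simps)
    moreover have "0 < c * (u \<bullet> u)" "0 < b * (v \<bullet> v)" using uv by auto
    ultimately show False using rs(1)
      by (smt (verit) mult_pos_pos mult_nonneg_nonneg zero_less_power2 zero_le_power2)
  qed
qed

text \<open>
  On the hyperplane \<open>x \<bullet> (A *v y) = 0\<close> the form is nonpositive, so it is maximal at \<open>w\<close>. The
  reverse Cauchy--Schwarz inequality at \<open>w + s z\<close> for all real \<open>s\<close> gives the first-order
  condition for every \<open>z\<close>, including \<open>z\<close> outside the hyperplane.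
\<close>

lemma reverse_Cauchy_Schwarz_null:
  fixes A :: "real^'n^'n"
  assumes sym: "transpose A = A" and x: "0 < x \<bullet> (A *v x)" and CS: "reverse_Cauchy_Schwarz A x"
    and w: "x \<bullet> (A *v w) = 0" "0 \<le> w \<bullet> (A *v w)"
  shows "A *v w = 0"
proof -
  have "z \<bullet> (A *v w) = 0" for z
  proof -
    let ?q = "\<lambda>y. y \<bullet> (A *v y)"
    have "0 \<le> 2 * s * (- ?q x * (w \<bullet> (A *v z))) + s\<^sup>2 * ((x \<bullet> (A *v z))\<^sup>2 - ?q x * ?q z)" for s
    proof -
      have "?q x * (?q w + 2 * s * (w \<bullet> (A *v z)) + s\<^sup>2 * ?q z) \<le> (s * (x \<bullet> (A *v z)))\<^sup>2"
        using CS[unfolded reverse_Cauchy_Schwarz_def, rule_format, of "w + s *\<^sub>R z"] w(1)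
        unfolding quadratic_form_add_scaleR[OF sym]
        by (simp add: matrix_vector_right_distrib matrix_vector_mult_scaleR inner_add_right)
      moreover have "0 \<le> ?q x * ?q w" using x w(2) by simp
      ultimately show ?thesis by (simp add: power_mult_distrib algebra_simps)
    qed
    then have "- ?q x * (w \<bullet> (A *v z)) = 0" by (rule linear_coeff_zero)
    then show ?thesis using x symmetric_inner_commute[OF sym, of z w] by simp
  qed
  then show ?thesis by (metis inner_eq_zero_iff)
qed

section \<open>Self-dual cones\<close>

lemma dual_cone_convex: "convex (dual_cone K)"
  unfolding convex_def dual_cone_def by (auto simp: inner_add_left)

lemma dual_cone_closed: "closed (dual_cone K)"
proof -
  have "dual_cone K = (\<Inter>x\<in>K. {y. 0 \<le> x \<bullet> y})" by (auto simp: dual_cone_def inner_commute)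
  then show ?thesis by (auto intro!: closed_INT simp: closed_halfspace_ge)
qed

lemma self_dual_cone_eq_dual_cone: "self_dual_cone K \<Longrightarrow> K = dual_cone K"
  by (simp only: self_dual_cone_def)

lemma self_dual_cone_memI:
  assumes "self_dual_cone K" "\<And>x. x \<in> K \<Longrightarrow> 0 \<le> y \<bullet> x"
  shows "y \<in> K"
  by (subst self_dual_cone_eq_dual_cone[OF assms(1)]) (simp add: dual_cone_def assms(2))

lemma self_dual_cone_inner_nonneg:
  assumes "self_dual_cone K" "x \<in> K" "y \<in> K"
  shows "0 \<le> x \<bullet> y"
proof -
  have "x \<in> dual_cone K" using assms self_dual_cone_eq_dual_cone by blast
  then show ?thesis using assms(3) by (simp add: dual_cone_def)
qed

lemma self_dual_cone_convex:
  assumes "self_dual_cone K"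
  shows "convex K"
  by (subst self_dual_cone_eq_dual_cone[OF assms]) (rule dual_cone_convex)

lemma self_dual_cone_closed:
  assumes "self_dual_cone K"
  shows "closed K"
  by (subst self_dual_cone_eq_dual_cone[OF assms]) (rule dual_cone_closed)

lemma self_dual_cone_zero: "self_dual_cone K \<Longrightarrow> 0 \<in> K"
  by (erule self_dual_cone_memI) simp

text \<open>
  A convex set with empty interior lies in a hyperplane. Its normal vector would belong to the
  dual cone, which is \<open>K\<close>, and hence be orthogonal to itself.
\<close>

lemma self_dual_cone_interior:
  assumes K: "self_dual_cone K"
  shows "interior K \<noteq> {}"
proof
  assume "interior K = {}"
  then obtain a b where ab: "a \<noteq> 0" "K \<subseteq> {x. a \<bullet> x = b}"
    using empty_interior_subset_hyperplane[OF self_dual_cone_convex[OF K]] by metis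
  then have "b = 0" using self_dual_cone_zero[OF K] by auto
  with ab have "a \<in> K" by (intro self_dual_cone_memI[OF K]) auto
  then have "a \<bullet> a = 0" using ab \<open>b = 0\<close> by blast
  then show False using ab by simp
qed

lemma self_dual_cone_closure_interior: "self_dual_cone K \<Longrightarrow> closure (interior K) = K"
  by (simp add: convex_closure_interior self_dual_cone_convex self_dual_cone_interior
      self_dual_cone_closed)

text \<open>
  Otherwise a small step from \<open>x\<close> in the direction \<open>- y\<close> would stay in \<open>K\<close> and have a negative
  inner product with \<open>y\<close>.
\<close>

lemma self_dual_cone_interior_pos:
  assumes K: "self_dual_cone K" and x: "x \<in> interior K" and y: "y \<in> K" "y \<noteq> 0"
  shows "0 < x \<bullet> y"
proof -
  obtain e where e: "0 < e" "cball x e \<subseteq> K" using x by (meson mem_interior_cball)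
  have "x - (e / norm y) *\<^sub>R y \<in> K" using e y(2) by (intro subsetD[OF e(2)]) (simp add: dist_norm)
  then have "0 \<le> (x - (e / norm y) *\<^sub>R y) \<bullet> y"
    using self_dual_cone_inner_nonneg[OF K] y(1) by blast
  also have "\<dots> = x \<bullet> y - e * norm y"
    using y(2) by (simp add: inner_diff_left dot_square_norm power2_eq_square)
  finally have "e * norm y \<le> x \<bullet> y" by simp
  moreover have "0 < e * norm y" using e(1) y(2) by simp
  ultimately show ?thesis by linarith
qed

lemma K_nonnegative_iff:
  assumes K: "self_dual_cone K"
  shows "K_nonnegative K A \<longleftrightarrow> (\<forall>x\<in>K. \<forall>y\<in>K. 0 \<le> y \<bullet> (A *v x))"
proof
  assume "K_nonnegative K A"
  then show "\<forall>x\<in>K. \<forall>y\<in>K. 0 \<le> y \<bullet> (A *v x)"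
    by (auto simp: K_nonnegative_def intro: self_dual_cone_inner_nonneg[OF K])
next
  assume "\<forall>x\<in>K. \<forall>y\<in>K. 0 \<le> y \<bullet> (A *v x)"
  then show "K_nonnegative K A"
    by (auto simp: K_nonnegative_def inner_commute intro!: self_dual_cone_memI[OF K])
qed

text \<open>
  The form is nonnegative on \<open>K\<close>. If it vanishes at \<open>x\<close>, then \<open>A *v x\<close> is an element of \<open>K\<close>
  orthogonal to an interior point, hence 0. By symmetry \<open>A *v z\<close> is orthogonal to \<open>x\<close> for each
  \<open>z\<close> in \<open>K\<close>, hence also 0. As \<open>K\<close> spans the space, this would make \<open>A\<close> zero.
\<close>

lemma K_nonnegative_interior_pos:
  fixes A :: "real^'n^'n"
  assumes K: "self_dual_cone K" and sym: "transpose A = A" and A: "K_nonnegative K A" "A \<noteq> 0"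
    and x: "x \<in> interior K"
  shows "0 < x \<bullet> (A *v x)"
proof (rule ccontr)
  assume neg: "\<not> 0 < x \<bullet> (A *v x)"
  have AK: "A *v z \<in> K" if "z \<in> K" for z using A that by (auto simp: K_nonnegative_def)
  have "x \<in> K" using x interior_subset by blast
  then have Ax: "A *v x = 0"
    using neg self_dual_cone_interior_pos[OF K x AK] by blast
  have AK0: "A *v z = 0" if "z \<in> K" for z
  proof (rule ccontr)
    assume "A *v z \<noteq> 0"
    then have "0 < x \<bullet> (A *v z)" using self_dual_cone_interior_pos[OF K x AK[OF that]] by blast
    then show False using symmetric_inner_commute[OF sym, of x z] Ax by simp
  qed
  obtain e where e: "0 < e" "cball x e \<subseteq> K" using x by (meson mem_interior_cball)
  have "A *v y = 0" for y
  proof (cases "y = 0")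
    case False
    have "x + (e / norm y) *\<^sub>R y \<in> K"
      using e False by (intro subsetD[OF e(2)]) (simp add: dist_norm)
    from AK0[OF this] show ?thesis
      using Ax False e(1) by (simp add: matrix_vector_right_distrib matrix_vector_mult_scaleR)
  qed simp
  then have "A = 0" by (simp add: matrix_eq)
  then show False using A by simp
qed

text \<open>
  A proper face misses the interior, so a hyperplane separates the two. Since \<open>K\<close> is a cone the
  hyperplane passes through 0, and by self-duality its normal vector lies in \<open>K\<close>.
\<close>

lemma proper_face_orthogonal:
  assumes K: "self_dual_cone K" and F: "proper_face F K"
  obtains u where "u \<in> K" "u \<noteq> 0" "\<And>v. v \<in> F \<Longrightarrow> u \<bullet> v = 0"
proof -
  have face: "F face_of K" "F \<noteq> {}" "F \<noteq> K" using F by (auto simp: proper_face_def)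
  have "F \<inter> interior K = {}" using face_of_disjoint_interior face by blast
  moreover have "convex F" using face face_of_imp_convex self_dual_cone_convex[OF K] by blast
  moreover have "convex (interior K)" using self_dual_cone_convex[OF K] by (rule convex_interior)
  ultimately obtain u b where u: "u \<noteq> 0" "\<forall>x\<in>F. u \<bullet> x \<le> b" "\<forall>x\<in>interior K. b \<le> u \<bullet> x"
    using separating_hyperplane_sets face(2) self_dual_cone_interior[OF K] by metis
  have ge: "b \<le> u \<bullet> x" if "x \<in> K" for x
  proof -
    have "closure (interior K) \<subseteq> {x. b \<le> u \<bullet> x}"
      using u(3) by (intro closure_minimal) (auto simp: closed_halfspace_ge)
    then show ?thesis using that self_dual_cone_closure_interior[OF K] by auto
  qed
  have eq: "u \<bullet> x = b" if "x \<in> F" for x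
    using that u(2) ge face(1) face_of_imp_subset by (metis antisym subsetD)
  \<comment> \<open>The cone contains \<open>0\<close> and \<open>2 v\<close> for each point \<open>v\<close> of the face.\<close>
  have "b = 0"
  proof -
    obtain v where v: "v \<in> F" using face(2) by blast
    then have "v \<in> K" using face(1) face_of_imp_subset by blast
    then have "2 *\<^sub>R v \<in> K" using K by (auto simp: self_dual_cone_def cone_def)
    then have "b \<le> 2 * b" using ge[of "2 *\<^sub>R v"] eq[OF v] by simp
    moreover have "b \<le> 0" using ge[OF self_dual_cone_zero[OF K]] by simp
    ultimately show ?thesis by simp
  qed
  show ?thesis
  proof (rule that)
    show "u \<in> K" using ge \<open>b = 0\<close> by (intro self_dual_cone_memI[OF K]) blast
  qed (use u eq \<open>b = 0\<close> in auto)
qed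

text \<open>
  An invariant face would give two orthogonal directions \<open>u\<close> and \<open>v\<close> in \<open>K\<close> that are also
  orthogonal for the form, on which the form is nonnegative; a suitable \<open>v + t u\<close> is then in the
  kernel by \<open>reverse_Cauchy_Schwarz_null\<close>.
\<close>

lemma K_irreducible_if_reverse_Cauchy_Schwarz:
  fixes A :: "real^'n^'n"
  assumes K: "self_dual_cone K" and sym: "transpose A = A" and A: "K_nonnegative K A"
    and inv: "invertible A" and x: "x \<in> interior K" and CS: "reverse_Cauchy_Schwarz A x"
  shows "K_irreducible K A"
  unfolding K_irreducible_def
proof (intro conjI notI A, elim exE conjE)
  fix F
  assume F: "proper_face F K" and AF: "(\<lambda>x. A *v x) ` F \<subseteq> F"
  have inj: "w = 0" if "A *v w = 0" for w
  proof -
    obtain B where "B ** A = mat 1" using inv unfolding invertible_def by blast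
    then have "w = B *v (A *v w)" by (simp add: matrix_vector_mul_assoc)
    then show "w = 0" using that by simp
  qed
  obtain v where v: "v \<in> F" "v \<noteq> 0" using F unfolding proper_face_def by blast
  have "A \<noteq> 0" using inj[of v] v(2) by auto
  then have qx: "0 < x \<bullet> (A *v x)" using K_nonnegative_interior_pos[OF K sym A _ x] by blast
  have nonneg: "0 \<le> z \<bullet> (A *v y)" if "y \<in> K" "z \<in> K" for y z
    using A that by (simp add: K_nonnegative_iff[OF K])
  obtain u where u: "u \<in> K" "u \<noteq> 0" "\<And>v. v \<in> F \<Longrightarrow> u \<bullet> v = 0"
    using proper_face_orthogonal[OF K F] by metis
  have vK: "v \<in> K" using v F face_of_imp_subset unfolding proper_face_def by blast
  have uAv: "u \<bullet> (A *v v) = 0" using u(3) AF v by blast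
  have "A *v u \<in> K" using A u(1) by (auto simp: K_nonnegative_def)
  moreover have "A *v u \<noteq> 0" using inj u(2) by blast
  ultimately have xu: "0 < x \<bullet> (A *v u)" by (rule self_dual_cone_interior_pos[OF K x])
  define t where "t = - (x \<bullet> (A *v v)) / (x \<bullet> (A *v u))"
  have "t * (x \<bullet> (A *v u)) = - (x \<bullet> (A *v v))" using xu by (simp add: t_def)
  then have "x \<bullet> (A *v (v + t *\<^sub>R u)) = 0"
    by (simp add: matrix_vector_right_distrib matrix_vector_mult_scaleR inner_add_right)
  moreover have "0 \<le> (v + t *\<^sub>R u) \<bullet> (A *v (v + t *\<^sub>R u))"
    unfolding quadratic_form_add_scaleR[OF sym] symmetric_inner_commute[OF sym, of v u] uAv
    using nonneg[OF vK vK] nonneg[OF u(1) u(1)] by simp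
  ultimately have "A *v (v + t *\<^sub>R u) = 0" by (rule reverse_Cauchy_Schwarz_null[OF sym qx CS])
  then have "v + t *\<^sub>R u = 0" by (rule inj)
  then have "v \<bullet> (v + t *\<^sub>R u) = 0" by simp
  then show False using u(3)[OF v(1)] v(2) by (simp add: inner_add_right inner_commute)
qed

section \<open>Hessians of Lorentzian forms\<close>

lemma lorentzian_hessian_interior:
  assumes L: "K_lorentzian K d f" and a: "a \<in> interior K"
    and x: "x \<in> interior K" and y: "y \<in> interior K"
  shows "0 < y \<bullet> (hessian f a *v x)" and "reverse_Cauchy_Schwarz (hessian f a) x"
proof -
  define m where "m = d - 2"
  have "2 \<le> d" "is_form d f" using L by (simp_all add: K_lorentzian_def)
  moreover from this have "m + 2 = d" by (simp add: m_def)
  ultimately have f: "hform (m + 2) f" using is_form_imp_hform by metis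
  have "length (replicate m a) = d - 2 \<and> set (replicate m a) \<subseteq> interior K"
    using a by (auto simp: m_def)
  then have "\<exists>Q. transpose Q = Q \<and> (\<forall>x. foldr dir_deriv (replicate m a) f x = x \<bullet> (Q *v x)) \<and>
      num_pos_eigenvalues Q = 1 \<and> (\<forall>x\<in>interior K. \<forall>y\<in>interior K. 0 < y \<bullet> (Q *v x))"
    using L unfolding K_lorentzian_def by blast
  then obtain Q where sym: "transpose Q = Q"
    and Q: "\<forall>x. (dir_deriv a ^^ m) f x = x \<bullet> (Q *v x)"
    and num: "num_pos_eigenvalues Q = 1"
    and pos: "\<forall>x\<in>interior K. \<forall>y\<in>interior K. 0 < y \<bullet> (Q *v x)"
    by (auto simp: foldr_replicate)
  have "(dir_deriv a ^^ m) f = (\<lambda>x. x \<bullet> (Q *v x))" using Q by auto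
  then have "fact m *\<^sub>R hessian f a = 2 *\<^sub>R Q"
    using hessian_iterated_dir_deriv[OF f, of a 0] hessian_quadratic_form[OF sym, of 0] by simp
  then have "(1 / fact m) *\<^sub>R (fact m *\<^sub>R hessian f a) = (1 / fact m) *\<^sub>R (2 *\<^sub>R Q)" by simp
  then have "hessian f a = (2 / fact m) *\<^sub>R Q" by simp
  moreover have "(0::real) < 2 / fact m" by simp
  ultimately obtain k where k: "0 < k" "hessian f a = k *\<^sub>R Q" by blast
  have kQ: "hessian f a *v z = k *\<^sub>R (Q *v z)" for z
    by (simp add: k(2) scaleR_matrix_vector_assoc)
  show "0 < y \<bullet> (hessian f a *v x)" using pos x y k(1) by (simp add: kQ)
  have "reverse_Cauchy_Schwarz Q x"
    using reverse_Cauchy_Schwarz_if_num_pos_eigenvalues_1[OF sym num] pos x by blast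
  then show "reverse_Cauchy_Schwarz (hessian f a) x"
    using k(1) by (simp add: reverse_Cauchy_Schwarz_def kQ power_mult_distrib power2_eq_square mult_ac)
qed

text \<open>
  All conditions are closed, and \<open>K\<close> is the closure of its interior. The base point \<open>a\<close> moves to
  the boundary while the vectors from the interior stay fixed; for nonnegativity the two vectors
  then follow, one after the other.
\<close>

lemma lorentzian_hessian_cone:
  fixes K :: "(real^'n) set"
  assumes K: "self_dual_cone K" and L: "K_lorentzian K d f" and a: "a \<in> K"
  shows "K_nonnegative K (hessian f a)"
    and "x \<in> interior K \<Longrightarrow> reverse_Cauchy_Schwarz (hessian f a) x"
proof -
  have "hform d f" using L is_form_imp_hform by (auto simp: K_lorentzian_def)
  from continuous_on_hessian[OF this]
  have cont: "continuous_on UNIV (\<lambda>b. z \<bullet> (hessian f b *v y))" for y z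
    unfolding matrix_vector_mult_def
    by (intro continuous_on_inner continuous_on_const continuous_on_vec_lambda continuous_on_sum
        continuous_on_mult continuous_on_component)
  have extend: "b \<in> S" if "closed S" "interior K \<subseteq> S" "b \<in> K" for S :: "(real^'n) set" and b
    using closure_minimal[OF that(2) that(1)] that(3)
    by (simp add: self_dual_cone_closure_interior[OF K] subset_iff)
  have 1: "0 \<le> z \<bullet> (hessian f a *v y)" if "y \<in> interior K" "z \<in> interior K" for y z
  proof -
    have "a \<in> {b. 0 \<le> z \<bullet> (hessian f b *v y)}"
    proof (rule extend[OF _ _ a])
      show "closed {b. 0 \<le> z \<bullet> (hessian f b *v y)}"
        by (intro closed_Collect_le continuous_on_const cont)
    qed (use lorentzian_hessian_interior(1)[OF L _ that] in \<open>auto intro: less_imp_le\<close>)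
    then show ?thesis by simp
  qed
  have 2: "0 \<le> z \<bullet> (hessian f a *v y)" if "y \<in> interior K" "z \<in> K" for y z
  proof -
    have "z \<in> {z. 0 \<le> (hessian f a *v y) \<bullet> z}"
      using 1[OF that(1)]
      by (intro extend[OF _ _ that(2)] closed_Collect_le continuous_intros) (auto simp: inner_commute)
    then show ?thesis by (simp add: inner_commute)
  qed
  have 3: "0 \<le> z \<bullet> (hessian f a *v y)" if "y \<in> K" "z \<in> K" for y z
  proof -
    have "y \<in> {y. 0 \<le> (z v* hessian f a) \<bullet> y}"
      using 2[OF _ that(2)]
      by (intro extend[OF _ _ that(1)] closed_Collect_le continuous_intros) (auto simp: dot_lmul_matrix)
    then show ?thesis by (simp add: dot_lmul_matrix)
  qed
  then show "K_nonnegative K (hessian f a)" by (simp add: K_nonnegative_iff[OF K])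
  show "reverse_Cauchy_Schwarz (hessian f a) x" if x: "x \<in> interior K"
    unfolding reverse_Cauchy_Schwarz_def
  proof
    fix y
    let ?S = "{b. (x \<bullet> (hessian f b *v x)) * (y \<bullet> (hessian f b *v y)) \<le> (x \<bullet> (hessian f b *v y))\<^sup>2}"
    have "a \<in> ?S"
    proof (rule extend[OF _ _ a])
      show "closed ?S"
        by (intro closed_Collect_le continuous_on_mult continuous_on_power cont)
    qed (use lorentzian_hessian_interior(2)[OF L _ x x] in \<open>auto simp: reverse_Cauchy_Schwarz_def\<close>)
    then show "(x \<bullet> (hessian f a *v x)) * (y \<bullet> (hessian f a *v y)) \<le> (x \<bullet> (hessian f a *v y))\<^sup>2"
      by simp
  qed
qed

theorem theorem3p7:
  fixes K :: "(real^'n) set" and f :: "real^'n \<Rightarrow> real" and d :: nat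
  assumes "self_dual_cone K" and "2 \<le> d" and "K_lorentzian K d f"
  shows "\<forall>a\<in>K.
    ((invertible (hessian f a) \<and> K_irreducible K (hessian f a)) \<or>
     (\<not> invertible (hessian f a) \<and> K_nonnegative K (hessian f a))) \<and>
    (a \<in> interior K \<or> hessian f a \<noteq> 0 \<longrightarrow> num_pos_eigenvalues (hessian f a) = 1)"
proof
  fix a assume a: "a \<in> K"
  let ?H = "hessian f a"
  note K = assms(1) and L = assms(3)
  have sym: "transpose ?H = ?H"
  proof (rule transpose_hessian[OF is_form_imp_hform])
    show "is_form d f" using L by (simp add: K_lorentzian_def)
  qed
  obtain x where x: "x \<in> interior K" using self_dual_cone_interior[OF K] by blast
  note nonneg = lorentzian_hessian_cone(1)[OF K L a]
  note CS = lorentzian_hessian_cone(2)[OF K L a x]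
  have "num_pos_eigenvalues ?H = 1" if "a \<in> interior K \<or> ?H \<noteq> 0"
  proof -
    have "?H \<noteq> 0" using that lorentzian_hessian_interior(1)[OF L _ x x] by fastforce
    then have "0 < x \<bullet> (?H *v x)" by (intro K_nonnegative_interior_pos[OF K sym nonneg _ x])
    then show ?thesis by (rule num_pos_eigenvalues_1_if_reverse_Cauchy_Schwarz[OF sym _ CS])
  qed
  then show "((invertible ?H \<and> K_irreducible K ?H) \<or> (\<not> invertible ?H \<and> K_nonnegative K ?H)) \<and>
    (a \<in> interior K \<or> ?H \<noteq> 0 \<longrightarrow> num_pos_eigenvalues ?H = 1)"
    using K_irreducible_if_reverse_Cauchy_Schwarz[OF K sym nonneg _ x CS] nonneg by blast
qed

end
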